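(* Let $G$ be a surjunctive group and let $K$ be a field. Then the group ring $K[G]$ is stably finite.
   Context: For a group $G$ and a set $A$, $A^G$ denotes the set of all maps $x \colon G \to A$. The prodiscrete topology on $A^G = \prod_{g \in G} A$ is the product topology obtained by giving each factor $A$ the discrete topology. For $g \in G$, let $L_g \colon G \to G$, $h \mapsto gh$, be left multiplication by $g$; the group $G$ acts on $A^G$ by the maps $x \mapsto x \circ L_g$, and a map $\tau \colon A^G \to A^G$ is $G$-equivariant if $\tau(x \circ L_g) = \tau(x) \circ L_g$ for all $g \in G$ and $x \in A^G$. A group $G$ is surjunctive if, for any finite set $A$, every injective $G$-equivariant map $\tau \colon A^G \to A^G$ which is continuous with respect to the prodiscrete topology on $A^G$ is surjective. For a group $G$ and a field $K$, the group ring $K[G]$ is the set of all finitely supported maps $\alpha \colon G \to K$, with pointwise addition and the convolution product $(\alpha\beta)(g) = \sum_{h_1 h_2 = g} \alpha(h_1)\beta(h_2)$. All rings are associative and unital. A ring $R$ is stably finite if, for every integer $d \geq 1$, every one-sided invertible matrix in $\mathrm{Mat}_d(R)$ (the ring of $d \times d$ matrices with entries in $R$) is two-sided invertible; equivalently, for all $d \geq 1$ and all $A, B \in \mathrm{Mat}_d(R)$, $AB = 1$ implies $BA = 1$. *)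

theory Defs
  imports
    "HOL-Analysis.Function_Topology"
    "HOL-Library.Poly_Mapping"
    "Jordan_Normal_Form.Matrix"
begin

text \<open>
  Groups are types of class \<^class>\<open>group_add\<close>: the group law is written \<open>+\<close> but it is not
  assumed to be commutative.  So left multiplication by \<open>g\<close> is \<open>(+) g\<close>, and
  \<open>'g \<Rightarrow>\<^sub>0 'k\<close> with the convolution product of \<^theory>\<open>HOL-Library.Poly_Mapping\<close>
  is the group ring \<open>K[G]\<close>.
\<close>

definition configs :: "'g itself \<Rightarrow> 'a set \<Rightarrow> ('g \<Rightarrow> 'a) set" where
  "configs G A = {x. range x \<subseteq> A}"

definition prodiscrete :: "'g itself \<Rightarrow> 'a set \<Rightarrow> ('g \<Rightarrow> 'a) topology" where
  "prodiscrete G A = product_topology (\<lambda>_::'g. discrete_topology A) UNIV"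

definition equivariant :: "'g::group_add itself \<Rightarrow> 'a set \<Rightarrow> (('g \<Rightarrow> 'a) \<Rightarrow> ('g \<Rightarrow> 'a)) \<Rightarrow> bool" where
  "equivariant G A \<tau> \<longleftrightarrow> (\<forall>g. \<forall>x\<in>configs G A. \<tau> (x \<circ> (+) g) = \<tau> x \<circ> (+) g)"

definition surjunctive_alphabet :: "'g::group_add itself \<Rightarrow> 'a set \<Rightarrow> bool" where
  "surjunctive_alphabet G A \<longleftrightarrow>
     (\<forall>\<tau>. \<tau> \<in> configs G A \<rightarrow> configs G A \<and>
          inj_on \<tau> (configs G A) \<and>
          equivariant G A \<tau> \<and>
          continuous_map (prodiscrete G A) (prodiscrete G A) \<tau>
        \<longrightarrow> \<tau> ` configs G A = configs G A)"

text \<open>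
  A definition cannot quantify over the type of the alphabet, so the finite alphabets range over
  the finite subsets of \<^typ>\<open>nat\<close>.  Lemma \<open>surjunctive_alphabetI\<close> below shows that this yields
  the property for finite alphabets in every type.
\<close>

definition surjunctive :: "'g::group_add itself \<Rightarrow> bool" where
  "surjunctive G \<longleftrightarrow> (\<forall>A :: nat set. finite A \<longrightarrow> surjunctive_alphabet G A)"

definition stably_finite :: "'r::ring_1 itself \<Rightarrow> bool" where
  "stably_finite R \<longleftrightarrow>
     (\<forall>d\<ge>1. \<forall>A \<in> carrier_mat d d.
        (\<exists>B :: 'r mat \<in> carrier_mat d d. A * B = 1\<^sub>m d \<or> B * A = 1\<^sub>m d) \<longrightarrow> invertible_mat A)"

lemma topspace_prodiscrete [simp]: "topspace (prodiscrete G A) = configs G A"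
  by (auto simp: prodiscrete_def configs_def PiE_def Pi_def)

lemma continuous_map_prodiscrete_comp:
  assumes "e ` A \<subseteq> B"
  shows "continuous_map (prodiscrete G A) (prodiscrete (G :: 'g itself) B) (\<lambda>x. e \<circ> x)"
proof -
  have "continuous_map (prodiscrete G A) (discrete_topology B) (\<lambda>x. e (x i))" for i :: 'g
  proof -
    have "continuous_map (prodiscrete G A) (discrete_topology A) (\<lambda>x. x i)"
      unfolding prodiscrete_def by (rule continuous_map_product_projection) simp
    moreover have "continuous_map (discrete_topology A) (discrete_topology B) e"
      using assms by auto
    ultimately have "continuous_map (prodiscrete G A) (discrete_topology B) (e \<circ> (\<lambda>x. x i))"
      by (rule continuous_map_compose)
    then show ?thesis by (simp add: o_def)
  qed
  then show ?thesis
    unfolding prodiscrete_def[of G B] continuous_map_componentwise_UNIV by (simp add: o_def)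
qed

lemma surjunctive_alphabetI:
  fixes A :: "'a set" and G :: "'g::group_add itself"
  assumes G: "surjunctive G" and A: "finite A"
  shows "surjunctive_alphabet G A"
  unfolding surjunctive_alphabet_def
proof (intro allI impI, elim conjE)
  fix \<tau> :: "('g \<Rightarrow> 'a) \<Rightarrow> ('g \<Rightarrow> 'a)"
  assume maps: "\<tau> \<in> configs G A \<rightarrow> configs G A" and inj: "inj_on \<tau> (configs G A)"
    and eqv: "equivariant G A \<tau>"
    and cont: "continuous_map (prodiscrete G A) (prodiscrete G A) \<tau>"
  obtain e :: "'a \<Rightarrow> nat" where e: "inj_on e A"
    using finite_imp_inj_to_nat_seg[OF A] by (elim exE conjE)
  define B where "B = e ` A"
  define d where "d = inv_into A e"
  have de: "d (e a) = a" if "a \<in> A" for a using e that by (simp add: d_def)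
  have ed: "e (d b) = b" if "b \<in> B" for b using that de by (auto simp: B_def)
  have dB: "d ` B \<subseteq> A" using de by (auto simp: B_def)
  have eA: "e ` A \<subseteq> B" by (simp add: B_def)
  have E: "e \<circ> x \<in> configs G B" "d \<circ> (e \<circ> x) = x" if "x \<in> configs G A" for x
    using that eA de by (auto simp: configs_def fun_eq_iff image_subset_iff)
  have D: "d \<circ> x \<in> configs G A" "e \<circ> (d \<circ> x) = x" if "x \<in> configs G B" for x
    using that dB ed by (auto simp: configs_def fun_eq_iff image_subset_iff)
  define \<sigma> where "\<sigma> = (\<lambda>x. e \<circ> \<tau> (d \<circ> x))"
  have tau: "\<tau> x \<in> configs G A" if "x \<in> configs G A" for x using maps that by auto
  have "\<sigma> \<in> configs G B \<rightarrow> configs G B"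
    by (auto simp: \<sigma>_def intro!: E(1) tau D(1))
  moreover have "inj_on \<sigma> (configs G B)"
  proof (rule inj_onI)
    fix x y assume x: "x \<in> configs G B" and y: "y \<in> configs G B" and "\<sigma> x = \<sigma> y"
    then have "d \<circ> (e \<circ> \<tau> (d \<circ> x)) = d \<circ> (e \<circ> \<tau> (d \<circ> y))" by (simp only: \<sigma>_def)
    then have "\<tau> (d \<circ> x) = \<tau> (d \<circ> y)" by (simp only: E(2)[OF tau[OF D(1)]] x y)
    then have "d \<circ> x = d \<circ> y" by (rule inj_onD[OF inj _ D(1)[OF x] D(1)[OF y]])
    then have "e \<circ> (d \<circ> x) = e \<circ> (d \<circ> y)" by (simp only:)
    then show "x = y" by (simp only: D(2)[OF x] D(2)[OF y])
  qed
  moreover have "equivariant G B \<sigma>"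
    unfolding equivariant_def
  proof (intro allI ballI)
    fix g x assume "x \<in> configs G B"
    then have "\<tau> (d \<circ> x \<circ> (+) g) = \<tau> (d \<circ> x) \<circ> (+) g"
      using eqv D(1) unfolding equivariant_def by blast
    then show "\<sigma> (x \<circ> (+) g) = \<sigma> x \<circ> (+) g" by (simp add: \<sigma>_def o_assoc)
  qed
  moreover have "continuous_map (prodiscrete G B) (prodiscrete G B) \<sigma>"
  proof -
    have "continuous_map (prodiscrete G B) (prodiscrete G B)
        ((\<lambda>x. e \<circ> x) \<circ> (\<tau> \<circ> (\<lambda>x. d \<circ> x)))"
      by (intro continuous_map_compose[of _ "prodiscrete G A"] cont
          continuous_map_prodiscrete_comp dB eA)
    then show ?thesis by (simp add: \<sigma>_def o_def)
  qed
  moreover have "finite B" using A by (simp add: B_def)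
  ultimately have surj: "\<sigma> ` configs G B = configs G B"
    using G[unfolded surjunctive_def surjunctive_alphabet_def, rule_format, of B \<sigma>] by simp
  show "\<tau> ` configs G A = configs G A"
  proof
    show "\<tau> ` configs G A \<subseteq> configs G A" using tau by blast
    show "configs G A \<subseteq> \<tau> ` configs G A"
    proof
      fix y assume y: "y \<in> configs G A"
      then obtain x where x: "x \<in> configs G B" "e \<circ> y = \<sigma> x" using E(1) surj by blast
      from x(2) have "d \<circ> (e \<circ> y) = d \<circ> (e \<circ> \<tau> (d \<circ> x))" by (simp only: \<sigma>_def)
      then have "y = \<tau> (d \<circ> x)" by (simp only: E(2)[OF y] E(2)[OF tau[OF D(1)[OF x(1)]]])
      then show "y \<in> \<tau> ` configs G A" using D(1) x(1) by blast
    qed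
  qed
qed

lemma stably_finite_iff:
  "stably_finite (R :: 'r::ring_1 itself) \<longleftrightarrow>
     (\<forall>d\<ge>1. \<forall>A \<in> carrier_mat d d. \<forall>B :: 'r mat \<in> carrier_mat d d.
        A * B = 1\<^sub>m d \<longrightarrow> B * A = 1\<^sub>m d)" (is "_ \<longleftrightarrow> ?R")
proof
  assume L: "stably_finite R"
  show ?R
  proof (intro allI impI ballI)
    fix d :: nat and A B :: "'r mat"
    assume d: "1 \<le> d" and A: "A \<in> carrier_mat d d" and B: "B \<in> carrier_mat d d"
      and AB: "A * B = 1\<^sub>m d"
    then have "invertible_mat A" using L unfolding stably_finite_def by blast
    then obtain C where AC: "A * C = 1\<^sub>m d" and CA: "C * A = 1\<^sub>m (dim_row C)"
      using A unfolding invertible_mat_def inverts_mat_def by auto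
    have "dim_row C = d" using arg_cong[OF CA, of dim_col] A by simp
    moreover have "dim_col C = d" using arg_cong[OF AC, of dim_col] by simp
    ultimately have C: "C \<in> carrier_mat d d" and CA': "C * A = 1\<^sub>m d" using CA by auto
    have "C = C * (A * B)" using AB C by simp
    also have "\<dots> = (C * A) * B" using A B C by (simp add: assoc_mult_mat)
    also have "\<dots> = B" using CA' B by simp
    finally show "B * A = 1\<^sub>m d" using CA' by simp
  qed
next
  assume R: ?R
  show "stably_finite R"
    unfolding stably_finite_def
  proof (intro allI impI ballI)
    fix d :: nat and A :: "'r mat"
    assume d: "1 \<le> d" and A: "A \<in> carrier_mat d d"
      and "\<exists>B :: 'r mat \<in> carrier_mat d d. A * B = 1\<^sub>m d \<or> B * A = 1\<^sub>m d"
    then obtain B where B: "B \<in> carrier_mat d d" and "A * B = 1\<^sub>m d \<or> B * A = 1\<^sub>m d" by blast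
    then have "A * B = 1\<^sub>m d \<and> B * A = 1\<^sub>m d" using R d A by blast
    then show "invertible_mat A"
      using A B unfolding invertible_mat_def inverts_mat_def by auto
  qed
qed

end

theory Submission
  imports Defs "HOL-Computational_Algebra.Polynomial"
begin

text \<open>
  Suppose \<open>A B = 1\<close>.  The coefficients of \<open>A\<close> and \<open>B\<close> lie in a finitely generated subring \<open>R\<close> of
  the field.  If \<open>B A - 1\<close> had a coefficient \<open>c \<noteq> 0\<close>, there would be a proper ideal \<open>I\<close> of finite
  index in \<open>R\<close> modulo which \<open>c\<close> is a unit; such ideals are constructed by adjoining one generator
  at a time.  Over the finite alphabet \<open>(R/I)\<^sup>d\<close> the matrices act as cellular automata, the one of \<open>B\<close>
  is injective since \<open>A B = 1\<close>, hence surjective, hence \<open>B A = 1\<close> modulo \<open>I\<close>, so that \<open>c \<in> I\<close>, a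
  contradiction.
\<close>

section \<open>Subrings and ideals\<close>

locale unital_subring =
  fixes R :: "'a::comm_ring_1 set"
  assumes one_mem [simp, intro]: "1 \<in> R"
    and diff_mem [intro]: "a \<in> R \<Longrightarrow> b \<in> R \<Longrightarrow> a - b \<in> R"
    and mult_mem [intro]: "a \<in> R \<Longrightarrow> b \<in> R \<Longrightarrow> a * b \<in> R"
begin

lemma zero_mem [simp, intro]: "0 \<in> R"
  using diff_mem[of 1 1] by simp

lemma uminus_mem [intro]: "a \<in> R \<Longrightarrow> - a \<in> R"
  using diff_mem[of 0 a] by simp

lemma add_mem [intro]: "a \<in> R \<Longrightarrow> b \<in> R \<Longrightarrow> a + b \<in> R"
  using diff_mem[of a "- b"] by auto

lemma power_mem [intro]: "a \<in> R \<Longrightarrow> a ^ n \<in> R"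
  by (induction n) auto

lemma sum_mem [intro]: "(\<And>i. i \<in> S \<Longrightarrow> f i \<in> R) \<Longrightarrow> sum f S \<in> R"
  by (induction S rule: infinite_finite_induct) auto

end

locale subring_ideal = unital_subring +
  fixes I :: "'a::comm_ring_1 set"
  assumes ideal_subset: "I \<subseteq> R"
    and ideal_zero [simp, intro]: "0 \<in> I"
    and ideal_add [intro]: "a \<in> I \<Longrightarrow> b \<in> I \<Longrightarrow> a + b \<in> I"
    and ideal_mult [intro]: "r \<in> R \<Longrightarrow> a \<in> I \<Longrightarrow> r * a \<in> I"
begin

lemma ideal_mem [intro]: "a \<in> I \<Longrightarrow> a \<in> R"
  using ideal_subset by blast

lemma ideal_mult_right [intro]: "r \<in> R \<Longrightarrow> a \<in> I \<Longrightarrow> a * r \<in> I"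
  using ideal_mult[of r a] by (simp add: mult.commute)

lemma ideal_uminus [intro]: "a \<in> I \<Longrightarrow> - a \<in> I"
  using ideal_mult[of "- 1" a] by auto

lemma ideal_diff [intro]: "a \<in> I \<Longrightarrow> b \<in> I \<Longrightarrow> a - b \<in> I"
  using ideal_add[of a "- b"] by auto

lemma ideal_sum [intro]: "(\<And>i. i \<in> S \<Longrightarrow> f i \<in> I) \<Longrightarrow> sum f S \<in> I"
  by (induction S rule: infinite_finite_induct) auto

lemma ideal_diff_trans: "a - b \<in> I \<Longrightarrow> b - c \<in> I \<Longrightarrow> a - c \<in> I"
  using ideal_add[of "a - b" "b - c"] by simp

lemma ideal_diff_commute: "a - b \<in> I \<longleftrightarrow> b - a \<in> I"
  using ideal_uminus[of "a - b"] ideal_uminus[of "b - a"] by auto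

lemma ideal_power_diff_one:
  assumes "a \<in> R" "a - 1 \<in> I"
  shows "a ^ n - 1 \<in> I"
proof (induction n)
  case (Suc n)
  have "a * (a ^ n - 1) + (a - 1) \<in> I" using Suc assms by blast
  then show ?case by (simp add: algebra_simps)
qed simp

end

definition finite_index :: "'a::comm_ring_1 set \<Rightarrow> 'a set \<Rightarrow> bool" where
  "finite_index R I \<longleftrightarrow> (\<exists>T. finite T \<and> (\<forall>r\<in>R. \<exists>t\<in>T. r - t \<in> I))"

definition unit_mod :: "'a::comm_ring_1 set \<Rightarrow> 'a set \<Rightarrow> 'a \<Rightarrow> bool" where
  "unit_mod R I c \<longleftrightarrow> (\<exists>b\<in>R. c * b - 1 \<in> I)"

text \<open>The invariant of the induction on generators. Asking that \<open>c\<close> become a unit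
  in a finite nonzero quotient, not merely stay nonzero, lets the leading coefficients met on the
  way be inverted.\<close>

definition units_survive :: "'a::comm_ring_1 set \<Rightarrow> bool" where
  "units_survive R \<longleftrightarrow> unital_subring R \<and>
     (\<forall>c\<in>R. c \<noteq> 0 \<longrightarrow> (\<exists>I. subring_ideal R I \<and> 1 \<notin> I \<and> finite_index R I \<and> unit_mod R I c))"

section \<open>Polynomials with coefficients in a subring\<close>

text \<open>\<open>R[X]\<close> as a subset of the polynomials over the ambient ring, since
  \<open>R\<close> is a set and not a type. The same definition gives \<open>I[X]\<close> for an
  ideal \<open>I\<close>.\<close>

definition polys_over :: "'a::zero set \<Rightarrow> 'a poly set" where
  "polys_over R = {p. \<forall>n. coeff p n \<in> R}"

lemma polys_overI: "(\<And>n. coeff p n \<in> R) \<Longrightarrow> p \<in> polys_over R"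
  by (simp add: polys_over_def)

lemma polys_overD: "p \<in> polys_over R \<Longrightarrow> coeff p n \<in> R"
  by (simp add: polys_over_def)

context unital_subring
begin

lemma unital_subring_polys_over: "unital_subring (polys_over R)"
proof
  show "1 \<in> polys_over R"
    by (rule polys_overI) (simp add: coeff_1)
next
  fix p q assume pq: "p \<in> polys_over R" "q \<in> polys_over R"
  show "p - q \<in> polys_over R"
    using pq by (auto simp: polys_over_def)
  show "p * q \<in> polys_over R"
    using pq by (auto simp: polys_over_def coeff_mult)
qed

interpretation P: unital_subring "polys_over R"
  by (rule unital_subring_polys_over)

lemma smult_mem [intro]: "a \<in> R \<Longrightarrow> p \<in> polys_over R \<Longrightarrow> smult a p \<in> polys_over R"
  by (auto simp: polys_over_def)

lemma monom_mem [intro]: "a \<in> R \<Longrightarrow> monom a n \<in> polys_over R"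
  by (auto simp: polys_over_def)

lemma const_mem [intro]: "a \<in> R \<Longrightarrow> [:a:] \<in> polys_over R"
  using monom_mem[of a 0] by (simp add: monom_0)

text \<open>Long division without inverses: before each cancellation of the top term,
  \<open>h\<close> is multiplied by the leading coefficient of \<open>m\<close>, so a power of it
  accumulates.\<close>

lemma pseudo_division:
  assumes m: "m \<in> polys_over R" "0 < degree m" and "h \<in> polys_over R"
  obtains N q r where "q \<in> polys_over R" "r \<in> polys_over R" "degree r < degree m"
    "smult (lead_coeff m ^ N) h = m * q + r"
proof -
  have "\<exists>N q r. q \<in> polys_over R \<and> r \<in> polys_over R \<and> degree r < degree m \<and>
    smult (lead_coeff m ^ N) h = m * q + r"
    using \<open>h \<in> polys_over R\<close>
  proof (induction "degree h" arbitrary: h rule: less_induct)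
    case less
    show ?case
    proof (cases "degree h < degree m")
      case True
      then show ?thesis
        using less.prems by (intro exI[of _ 0] exI[of _ h]) auto
    next
      case False
      define s where "s = monom (lead_coeff h) (degree h - degree m)"
      have s: "s \<in> polys_over R"
        using less.prems unfolding s_def by (auto dest: polys_overD)
      define h' where "h' = smult (lead_coeff m) h - m * s"
      have h': "h' \<in> polys_over R"
        unfolding h'_def using m less.prems s by (auto dest: polys_overD)
      have "degree (m * s) \<le> degree h"
        using degree_mult_le[of m s] degree_monom_le[of "lead_coeff h" "degree h - degree m"] False
        unfolding s_def by linarith
      then have "degree h' \<le> degree h"
        unfolding h'_def by (intro degree_diff_le) (auto intro: order.trans[OF degree_smult_le])
      moreover have "coeff h' (degree h) = 0"
        using False by (simp add: h'_def s_def mult.commute[of m] coeff_monom_mult)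
      \<comment> \<open>Equality would force \<open>h' = 0\<close> and hence
        \<open>degree h = 0\<close>, against \<open>degree h \<ge> degree m > 0\<close>.\<close>
      ultimately have "degree h' < degree h"
        using False m(2) by (metis degree_0 gr0I le_neq_implies_less leading_coeff_0_iff not_less)
      from less.hyps[OF this h'] obtain N q r where
        qr: "q \<in> polys_over R" "r \<in> polys_over R" "degree r < degree m"
          "smult (lead_coeff m ^ N) h' = m * q + r"
        by blast
      have "smult (lead_coeff m ^ Suc N) h = smult (lead_coeff m ^ N) (h' + m * s)"
        by (simp add: h'_def mult.commute)
      also have "\<dots> = m * (q + smult (lead_coeff m ^ N) s) + r"
        by (simp add: smult_add_right qr(4) algebra_simps)
      finally have "smult (lead_coeff m ^ Suc N) h = m * (q + smult (lead_coeff m ^ N) s) + r" .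
      moreover have "q + smult (lead_coeff m ^ N) s \<in> polys_over R"
        using qr(1) s polys_overD[OF m(1)] by blast
      ultimately show ?thesis using qr(2,3) by blast
    qed
  qed
  then show thesis using that by blast
qed

end

context subring_ideal
begin

lemma subring_ideal_polys_over: "subring_ideal (polys_over R) (polys_over I)"
proof -
  interpret P: unital_subring "polys_over R" by (rule unital_subring_polys_over)
  show ?thesis
  proof
    show "polys_over I \<subseteq> polys_over R"
      by (auto simp: polys_over_def)
  qed (auto simp: polys_over_def coeff_mult)
qed

interpretation P: subring_ideal "polys_over R" "polys_over I"
  by (rule subring_ideal_polys_over)

lemma smult_ideal_left [intro]: "a \<in> I \<Longrightarrow> p \<in> polys_over R \<Longrightarrow> smult a p \<in> polys_over I"
  by (auto simp: polys_over_def)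

lemma smult_ideal_right [intro]: "a \<in> R \<Longrightarrow> p \<in> polys_over I \<Longrightarrow> smult a p \<in> polys_over I"
  by (auto simp: polys_over_def)

text \<open>Modulo \<open>I\<close> the leading coefficient of \<open>m\<close> is invertible, so
  multiplication by \<open>m\<close> raises degrees modulo \<open>I\<close> by
  \<open>degree m > 0\<close>. Hence \<open>m * g\<close> can be constant modulo \<open>I\<close>
  only if \<open>g\<close> vanishes modulo \<open>I\<close>, and then
  \<open>1 \<in> I\<close>.\<close>

lemma not_unit_mod_polys:
  assumes I: "1 \<notin> I" and m: "m \<in> polys_over R" "0 < degree m"
    and u: "unit_mod R I (lead_coeff m)" and g: "g \<in> polys_over R"
  shows "m * g - 1 \<notin> polys_over I"
proof
  assume mg: "m * g - 1 \<in> polys_over I"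
  have "g \<in> polys_over I"
  proof (rule ccontr)
    assume "g \<notin> polys_over I"
    then obtain k0 where k0: "coeff g k0 \<notin> I"
      by (auto simp: polys_over_def)
    define K where "K = {k. coeff g k \<notin> I}"
    have "K \<subseteq> {..degree g}"
      by (auto simp: K_def intro: le_degree)
    then have K: "finite K" by (rule finite_subset) simp
    \<comment> \<open>\<open>k\<close> is the degree of \<open>g\<close> modulo
      \<open>I\<close>.\<close>
    define k where "k = Max K"
    have k: "coeff g k \<notin> I"
      using Max_in[OF K] k0 by (auto simp: k_def K_def)
    have above: "coeff g l \<in> I" if "k < l" for l
      using Max_ge[OF K, of l] that by (auto simp: k_def K_def)
    define d where "d = degree m"
    \<comment> \<open>All terms of the coefficient of \<open>m * g\<close> at \<open>d + k\<close>
      except the product of the two top coefficients. For \<open>i < d\<close> the other index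
      exceeds \<open>k\<close>; for \<open>i > d\<close> the coefficient of \<open>m\<close>
      vanishes.\<close>
    define s where "s = (\<Sum>i\<in>{..d + k} - {d}. coeff m i * coeff g (d + k - i))"
    have rest: "s \<in> I"
      unfolding s_def
    proof (rule ideal_sum)
      fix i assume i: "i \<in> {..d + k} - {d}"
      show "coeff m i * coeff g (d + k - i) \<in> I"
      proof (cases "i < d")
        case True
        then show ?thesis using above[of "d + k - i"] polys_overD[OF m(1)] by auto
      next
        case False
        then have "coeff m i = 0" using i by (intro coeff_eq_0) (auto simp: d_def)
        then show ?thesis by simp
      qed
    qed
    have "coeff (m * g) (d + k) = coeff m d * coeff g k + s"
      unfolding coeff_mult s_def by (subst sum.remove[of _ d]) auto
    \<comment> \<open>Here \<open>d > 0\<close> matters: the coefficient of \<open>1\<close> at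
      \<open>d + k\<close> is zero.\<close>
    moreover have "coeff (m * g) (d + k) \<in> I"
      using polys_overD[OF mg, of "d + k"] m(2) by (simp add: coeff_1 d_def)
    ultimately have ak: "coeff m d * coeff g k \<in> I"
      using ideal_diff[OF _ rest, of "coeff m d * coeff g k + s"] by simp
    from u obtain b where b: "b \<in> R" "coeff m d * b - 1 \<in> I"
      unfolding unit_mod_def d_def by blast
    have "b * (coeff m d * coeff g k) - (coeff m d * b - 1) * coeff g k \<in> I"
      using ak b g by (blast dest: polys_overD)
    then show False using k by (simp add: algebra_simps)
  qed
  then have "m * g - (m * g - 1) \<in> polys_over I"
    using m mg by blast
  then have "coeff 1 0 \<in> I" by (auto dest: polys_overD[of _ _ 0])
  then show False using I by simp
qed

end

section \<open>Adjoining an element\<close>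

definition adjoin :: "'a::comm_ring_1 set \<Rightarrow> 'a \<Rightarrow> 'a set" where
  "adjoin R x = (\<lambda>p. poly p x) ` polys_over R"

context unital_subring
begin

interpretation P: unital_subring "polys_over R"
  by (rule unital_subring_polys_over)

lemma adjoinI: "p \<in> polys_over R \<Longrightarrow> poly p x \<in> adjoin R x"
  by (auto simp: adjoin_def)

lemma subset_adjoin: "R \<subseteq> adjoin R x"
  using adjoinI[OF const_mem, of _ x] by auto

lemma mem_adjoin: "x \<in> adjoin R x"
  using adjoinI[OF monom_mem[of 1 1], of x] by (simp add: poly_monom)

lemma unital_subring_adjoin: "unital_subring (adjoin R x)"
proof
  show "1 \<in> adjoin R x" using subset_adjoin by blast
next
  fix a b assume "a \<in> adjoin R x" "b \<in> adjoin R x"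
  then obtain p q where "p \<in> polys_over R" "a = poly p x" "q \<in> polys_over R" "b = poly q x"
    by (auto simp: adjoin_def)
  then show "a - b \<in> adjoin R x" "a * b \<in> adjoin R x"
    using adjoinI[of "p - q" x] adjoinI[of "p * q" x] by auto
qed

end

text \<open>
  The kernel of \<open>R[x] \<longrightarrow> (R/I)[X]/(m)\<close>, provided that this map is well-defined.
\<close>
definition adjoin_ideal :: "'a::comm_ring_1 set \<Rightarrow> 'a set \<Rightarrow> 'a poly \<Rightarrow> 'a \<Rightarrow> 'a set" where
  "adjoin_ideal R I m x = {poly (f + m * q) x | f q. f \<in> polys_over I \<and> q \<in> polys_over R}"

context subring_ideal
begin

interpretation P: subring_ideal "polys_over R" "polys_over I"
  by (rule subring_ideal_polys_over)

lemma adjoin_idealI: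
  "f \<in> polys_over I \<Longrightarrow> q \<in> polys_over R \<Longrightarrow> poly (f + m * q) x \<in> adjoin_ideal R I m x"
  by (auto simp: adjoin_ideal_def)

lemma subset_adjoin_ideal: "I \<subseteq> adjoin_ideal R I m x"
proof
  fix a assume "a \<in> I"
  then have "[:a:] \<in> polys_over I" by (auto simp: polys_over_def coeff_pCons split: nat.splits)
  from adjoin_idealI[OF this P.zero_mem, of m x] show "a \<in> adjoin_ideal R I m x" by simp
qed

lemma subring_ideal_adjoin:
  assumes m: "m \<in> polys_over R"
  shows "subring_ideal (adjoin R x) (adjoin_ideal R I m x)"
proof -
  interpret S: unital_subring "adjoin R x" by (rule unital_subring_adjoin)
  show ?thesis
  proof
    show "adjoin_ideal R I m x \<subseteq> adjoin R x"
      using m by (auto simp: adjoin_ideal_def simp del: poly_add poly_mult intro!: adjoinI)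
    show "0 \<in> adjoin_ideal R I m x" using subset_adjoin_ideal by blast
  next
    fix a b assume "a \<in> adjoin_ideal R I m x" "b \<in> adjoin_ideal R I m x"
    then obtain f q f' q' where "f \<in> polys_over I" "q \<in> polys_over R" "a = poly (f + m * q) x"
      "f' \<in> polys_over I" "q' \<in> polys_over R" "b = poly (f' + m * q') x"
      unfolding adjoin_ideal_def by blast
    then show "a + b \<in> adjoin_ideal R I m x"
      using adjoin_idealI[of "f + f'" "q + q'" m x] by (auto simp: algebra_simps)
  next
    fix r a assume "r \<in> adjoin R x" "a \<in> adjoin_ideal R I m x"
    then obtain f q p where "f \<in> polys_over I" "q \<in> polys_over R" "a = poly (f + m * q) x"
      "p \<in> polys_over R" "r = poly p x"
      unfolding adjoin_ideal_def adjoin_def by blast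
    then show "r * a \<in> adjoin_ideal R I m x"
      using adjoin_idealI[of "p * f" "p * q" m x] by (auto simp: algebra_simps)
  qed
qed

text \<open>As the leading coefficient of \<open>m\<close> is invertible modulo \<open>I\<close>,
  every polynomial over \<open>R\<close> is congruent modulo \<open>m\<close> and
  \<open>I[X]\<close> to one of degree below \<open>degree m\<close> whose coefficients are among
  finitely many representatives.\<close>

lemma finite_index_adjoin:
  assumes m: "m \<in> polys_over R" "0 < degree m" and u: "unit_mod R I (lead_coeff m)"
    and fin: "finite_index R I"
  shows "finite_index (adjoin R x) (adjoin_ideal R I m x)"
proof -
  from fin obtain T where T: "finite T" "\<And>r. r \<in> R \<Longrightarrow> \<exists>t\<in>T. r - t \<in> I"
    unfolding finite_index_def by blast
  then obtain t where t: "\<And>r. r \<in> R \<Longrightarrow> t r \<in> T \<and> r - t r \<in> I" by metis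
  define a where "a = lead_coeff m"
  from u obtain b where b: "b \<in> R" "a * b - 1 \<in> I" unfolding unit_mod_def a_def by blast
  have a: "a \<in> R" unfolding a_def using m(1) by (rule polys_overD)
  define d where "d = degree m"
  define T' where "T' = (\<lambda>l. poly (Poly l) x) ` {l. set l \<subseteq> T \<and> length l = d}"
  have "finite T'" unfolding T'_def by (intro finite_imageI finite_lists_length_eq T)
  moreover have "\<exists>t'\<in>T'. s - t' \<in> adjoin_ideal R I m x" if s: "s \<in> adjoin R x" for s
  proof -
    from s obtain h where h: "h \<in> polys_over R" "s = poly h x" by (auto simp: adjoin_def)
    obtain N q r where qr:
      "q \<in> polys_over R" "r \<in> polys_over R" "degree r < degree m" "smult (a ^ N) h = m * q + r"
      unfolding a_def by (rule pseudo_division[OF m h(1)])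
    \<comment> \<open>The factor \<open>b ^ N\<close> undoes the \<open>a ^ N\<close> of the
      pseudo-division, since \<open>a * b\<close> is 1 modulo \<open>I\<close>.\<close>
    define r' where "r' = smult (b ^ N) r"
    have r': "r' \<in> polys_over R" "degree r' < d"
      using qr b le_less_trans[OF degree_smult_le] unfolding r'_def d_def by auto
    define l where "l = map (\<lambda>i. t (coeff r' i)) [0..<d]"
    have l: "set l \<subseteq> T" "length l = d"
      using t polys_overD[OF r'(1)] by (auto simp: l_def)
    have rl: "r' - Poly l \<in> polys_over I"
    proof (rule polys_overI)
      fix n
      show "coeff (r' - Poly l) n \<in> I"
      proof (cases "n < d")
        case True
        then show ?thesis using t polys_overD[OF r'(1)] by (simp add: l_def nth_default_def)
      next
        case False
        then have "coeff r' n = 0" using r' by (intro coeff_eq_0) auto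
        then show ?thesis using False by (simp add: l_def nth_default_def)
      qed
    qed
    have "smult ((a * b) ^ N) h = smult (b ^ N) (smult (a ^ N) h)"
      by (simp add: power_mult_distrib mult.commute)
    also have "\<dots> = m * smult (b ^ N) q + r'"
      unfolding qr(4) r'_def by (simp add: smult_add_right)
    finally have "h - Poly l = (r' - Poly l) - smult ((a * b) ^ N - 1) h + m * smult (b ^ N) q"
      by (simp add: smult_diff_left algebra_simps)
    moreover have "(r' - Poly l) - smult ((a * b) ^ N - 1) h \<in> polys_over I"
      using rl h(1) ideal_power_diff_one[of "a * b" N] a b by auto
    ultimately have "poly (h - Poly l) x \<in> adjoin_ideal R I m x"
      using adjoin_idealI b qr by (metis power_mem smult_mem)
    then show ?thesis using l h unfolding T'_def by auto
  qed
  ultimately show ?thesis unfolding finite_index_def by blast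
qed

text \<open>The hypothesis \<open>kernel\<close> says that polynomials vanishing at \<open>x\<close>
  are multiples of \<open>m\<close> once its leading coefficient is inverted. If
  \<open>1 = f(x) + m(x) q(x)\<close>, then \<open>1 - f - m * q\<close> is such a polynomial, and
  \<open>m\<close> would become a unit modulo \<open>I[X]\<close>.\<close>

lemma one_notin_adjoin_ideal:
  assumes I: "1 \<notin> I" and m: "m \<in> polys_over R" "0 < degree m"
    and u: "unit_mod R I (lead_coeff m)"
    and kernel: "\<And>h. h \<in> polys_over R \<Longrightarrow> poly h x = 0 \<Longrightarrow>
      \<exists>N. \<exists>g\<in>polys_over R. smult (lead_coeff m ^ N) h = m * g"
  shows "1 \<notin> adjoin_ideal R I m x"
proof
  assume "1 \<in> adjoin_ideal R I m x"
  then obtain f q where fq: "f \<in> polys_over I" "q \<in> polys_over R" "1 = poly (f + m * q) x"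
    unfolding adjoin_ideal_def by blast
  define a where "a = lead_coeff m"
  from u obtain b where b: "b \<in> R" "a * b - 1 \<in> I" unfolding unit_mod_def a_def by blast
  have a: "a \<in> R" unfolding a_def using m(1) by (rule polys_overD)
  have h: "1 - f - m * q \<in> polys_over R" using fq m by auto
  have "poly (1 - f - m * q) x = 0" using fq(3) by (simp add: algebra_simps)
  from kernel[OF h this] obtain N g where
    g: "g \<in> polys_over R" "smult (a ^ N) (1 - f - m * q) = m * g"
    unfolding a_def by blast
  \<comment> \<open>Chosen so that \<open>m * g'\<close> equals \<open>1 - f\<close> scaled by
    \<open>(a * b) ^ N\<close>, which is 1 modulo \<open>I[X]\<close>.\<close>
  define g' where "g' = smult (b ^ N) g + smult ((a * b) ^ N) q"
  have "smult ((a * b) ^ N) (1 - f - m * q) = m * smult (b ^ N) g"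
    using arg_cong[OF g(2), of "smult (b ^ N)"] by (simp add: power_mult_distrib mult.commute)
  then have "m * g' = smult ((a * b) ^ N) (1 - f)"
    by (simp add: g'_def algebra_simps smult_diff_right smult_add_right)
  then have "m * g' - 1 = smult ((a * b) ^ N - 1) 1 - smult ((a * b) ^ N) f"
    by (simp only: smult_diff_left smult_diff_right smult_1_left) simp
  moreover have "smult ((a * b) ^ N - 1) 1 - smult ((a * b) ^ N) f \<in> polys_over I"
    using fq(1) ideal_power_diff_one[of "a * b" N] a b by blast
  moreover have "g' \<in> polys_over R" using g fq a b unfolding g'_def by auto
  ultimately show False using not_unit_mod_polys[OF I m u] by metis
qed

end

section \<open>Polynomials vanishing at the adjoined element, and units in the quotients of the
  extension\<close>

lemma unit_mod_mono: "unit_mod R I c \<Longrightarrow> R \<subseteq> S \<Longrightarrow> I \<subseteq> J \<Longrightarrow> unit_mod S J c"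
  unfolding unit_mod_def by blast

lemma (in subring_ideal) unit_mod_factor:
  assumes "unit_mod R I (a * b)" "a \<in> R" "b \<in> R"
  shows "unit_mod R I a"
  using assms unfolding unit_mod_def by (metis mult.assoc mult_mem)

text \<open>Take a nonzero polynomial of least degree vanishing at \<open>x\<close>; it is not
  constant because a nonzero constant has no root.\<close>

lemma exists_kernel_generator:
  fixes R :: "'a::idom set"
  assumes R: "unital_subring R" and p: "p \<in> polys_over R" "p \<noteq> 0" "poly p x = 0"
  obtains m where "m \<in> polys_over R" "0 < degree m" "poly m x = 0"
    "\<And>h. h \<in> polys_over R \<Longrightarrow> poly h x = 0 \<Longrightarrow> degree h < degree m \<Longrightarrow> h = 0"
proof -
  define Z where "Z h \<longleftrightarrow> h \<in> polys_over R \<and> h \<noteq> 0 \<and> poly h x = 0" for h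
  define m where "m = arg_min degree Z"
  have "Z p" using p by (simp add: Z_def)
  then have m: "Z m" and min: "\<And>h. Z h \<Longrightarrow> degree m \<le> degree h"
    unfolding m_def by (blast intro: arg_min_natI arg_min_nat_le)+
  have "0 < degree m"
  proof (rule ccontr)
    assume "\<not> 0 < degree m"
    then obtain c where "m = [:c:]" by (auto elim: degree_eq_zeroE)
    then show False using m by (simp add: Z_def)
  qed
  then show thesis
    using that[of m] m min unfolding Z_def by (meson leD)
qed

text \<open>The remainder in the pseudo-division of \<open>h\<close> by \<open>m\<close> vanishes at
  \<open>x\<close> and has degree below that of \<open>m\<close>, so it is zero.\<close>

lemma kernel_multiple:
  fixes R :: "'a::idom set"
  assumes R: "unital_subring R" and m: "m \<in> polys_over R" "0 < degree m" "poly m x = 0"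
    and min: "\<And>h. h \<in> polys_over R \<Longrightarrow> poly h x = 0 \<Longrightarrow> degree h < degree m \<Longrightarrow> h = 0"
    and h: "h \<in> polys_over R" "poly h x = 0"
  shows "\<exists>N. \<exists>g\<in>polys_over R. smult (lead_coeff m ^ N) h = m * g"
proof -
  interpret unital_subring R by fact
  obtain N q r where qr:
    "q \<in> polys_over R" "r \<in> polys_over R" "degree r < degree m"
    "smult (lead_coeff m ^ N) h = m * q + r"
      by (rule pseudo_division[OF m(1,2) h(1)])
  have "poly r x = 0"
    using arg_cong[OF qr(4), of "\<lambda>p. poly p x"] m h by simp
  then have "r = 0" using min qr by blast
  then show ?thesis using qr by auto
qed

text \<open>Among the polynomials over \<open>R\<close> whose value at \<open>x\<close> is a nonzero
  multiple of \<open>c\<close>, one of least degree is constant: otherwise it would divide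
  \<open>m\<close> up to a scalar, and the cofactor would be a polynomial vanishing at
  \<open>x\<close> of smaller degree than \<open>m\<close>.\<close>

lemma exists_multiple_in_subring:
  fixes R :: "'a::idom set"
  assumes R: "unital_subring R" and m: "m \<in> polys_over R" "0 < degree m" "poly m x = 0"
    and min: "\<And>h. h \<in> polys_over R \<Longrightarrow> poly h x = 0 \<Longrightarrow> degree h < degree m \<Longrightarrow> h = 0"
    and c: "c \<in> adjoin R x" "c \<noteq> 0"
  obtains v where "v \<in> adjoin R x" "c * v \<in> R" "c * v \<noteq> 0"
proof -
  interpret unital_subring R by fact
  interpret S: unital_subring "adjoin R x" by (rule unital_subring_adjoin)
  define W where "W w \<longleftrightarrow> w \<in> polys_over R \<and> poly w x \<noteq> 0 \<and>
    (\<exists>v\<in>adjoin R x. poly w x = c * v)" for w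
  define w where "w = arg_min degree W"
  obtain p where "p \<in> polys_over R" "c = poly p x" using c by (auto simp: adjoin_def)
  then have "W p" using c unfolding W_def by (auto intro!: bexI[of _ 1])
  then have w: "W w" and wmin: "\<And>w'. W w' \<Longrightarrow> degree w \<le> degree w'"
    unfolding w_def by (blast intro: arg_min_natI arg_min_nat_le)+
  then obtain v where v: "v \<in> adjoin R x" "poly w x = c * v" and
    wP: "w \<in> polys_over R" and w0: "poly w x \<noteq> 0" unfolding W_def by blast
  have lead: "lead_coeff p ^ N \<in> R" if "p \<in> polys_over R" for p N
    using that polys_overD by blast
  \<comment> \<open>Otherwise the remainder of \<open>w\<close> modulo \<open>m\<close> would have
    smaller degree and still lie in \<open>W\<close>, since the reduction only scales the value at
    \<open>x\<close> by a nonzero element of \<open>R\<close>.\<close>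
  have small: "degree w < degree m"
  proof (rule ccontr)
    assume "\<not> degree w < degree m"
    obtain N q r where qr:
      "q \<in> polys_over R" "r \<in> polys_over R" "degree r < degree m"
      "smult (lead_coeff m ^ N) w = m * q + r"
      by (rule pseudo_division[OF m(1,2) wP])
    have "poly r x = lead_coeff m ^ N * poly w x"
      using arg_cong[OF qr(4), of "\<lambda>p. poly p x"] m by simp
    moreover have "lead_coeff m ^ N * v \<in> adjoin R x"
      using lead[OF m(1)] v(1) subset_adjoin by blast
    moreover have "lead_coeff m \<noteq> 0" using m(2) by auto
    ultimately have "W r"
      using qr w0 v(2) unfolding W_def by (auto intro!: bexI[of _ "lead_coeff m ^ N * v"])
    then show False using wmin qr(3) \<open>\<not> degree w < degree m\<close> by force
  qed
  have "degree w = 0"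
  proof (rule ccontr)
    assume "degree w \<noteq> 0"
    then have deg: "0 < degree w" by simp
    obtain N q r where qr:
      "q \<in> polys_over R" "r \<in> polys_over R" "degree r < degree w"
      "smult (lead_coeff w ^ N) m = w * q + r"
      by (rule pseudo_division[OF wP deg m(1)])
    \<comment> \<open>As \<open>m\<close> vanishes at \<open>x\<close>, the value of the remainder
      is again a multiple of \<open>c\<close>; minimality of \<open>w\<close> then forces this value
      to be zero.\<close>
    have rx: "poly r x = c * - (v * poly q x)"
      using arg_cong[OF qr(4), of "\<lambda>p. poly p x"] m v(2)
      by (simp add: eq_neg_iff_add_eq_0 algebra_simps)
    have "- (v * poly q x) \<in> adjoin R x"
      using v(1) adjoinI[OF qr(1)] by blast
    then have "poly r x = 0"
      using wmin[of r] qr rx unfolding W_def by (metis leD)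
    then have "r = 0" using min[of r] qr small by simp
    then have eq: "smult (lead_coeff w ^ N) m = w * q" using qr(4) by simp
    \<comment> \<open>\<open>m\<close> vanishes at \<open>x\<close> and \<open>w\<close> does not,
      so the cofactor does.\<close>
    have "poly q x = 0"
      using arg_cong[OF eq, of "\<lambda>p. poly p x"] m w0 by simp
    have "lead_coeff w \<noteq> 0" "m \<noteq> 0" using deg m(2) by auto
    then have "w * q \<noteq> 0" using eq by (metis power_not_zero smult_eq_0_iff)
    then have "degree m = degree w + degree q" "q \<noteq> 0"
      using arg_cong[OF eq, of degree] \<open>lead_coeff w \<noteq> 0\<close> degree_mult_eq[of w q] by auto
    then show False using min[of q] qr(1) \<open>poly q x = 0\<close> deg by simp
  qed
  then obtain e where "w = [:e:]" by (auto elim: degree_eq_zeroE)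
  moreover from this have "e \<in> R" using polys_overD[OF wP, of 0] by simp
  ultimately show thesis using that[of v] v w0 by simp
qed

text \<open>
  If \<open>x\<close> is transcendental over \<open>R\<close> and \<open>c = p(x)\<close>, then \<open>R[x]/(x p(x) - 1)\<close> makes \<open>c\<close> a unit
  and is finite over \<open>R\<close> as soon as the leading coefficient of \<open>p\<close> is a unit.  If \<open>x\<close> is algebraic,
  then \<open>R[x]\<close> is finite over \<open>R\<close> as soon as the leading coefficient of a polynomial \<open>m\<close> of minimal
  degree is a unit, and \<open>c\<close> divides a nonzero element \<open>e\<close> of \<open>R\<close>.
\<close>
lemma adjoin_presentation:
  fixes R :: "'a::idom set"
  assumes R: "unital_subring R" and c: "c \<in> adjoin R x" "c \<noteq> 0"
  obtains m e where "m \<in> polys_over R" "0 < degree m" "e \<in> R" "e \<noteq> 0"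
    "\<And>h. h \<in> polys_over R \<Longrightarrow> poly h x = 0 \<Longrightarrow>
      \<exists>N. \<exists>g\<in>polys_over R. smult (lead_coeff m ^ N) h = m * g"
    "\<And>I. subring_ideal R I \<Longrightarrow> unit_mod R I e \<Longrightarrow> unit_mod (adjoin R x) (adjoin_ideal R I m x) c"
proof -
  interpret unital_subring R by fact
  interpret P: unital_subring "polys_over R" by (rule unital_subring_polys_over)
  interpret S: unital_subring "adjoin R x" by (rule unital_subring_adjoin)
  show thesis
  proof (cases "\<forall>h\<in>polys_over R. poly h x = 0 \<longrightarrow> h = 0")
    case True
    obtain p where p: "p \<in> polys_over R" "c = poly p x" using c by (auto simp: adjoin_def)
    then have "p \<noteq> 0" using c by auto
    \<comment> \<open>This is \<open>X p - 1\<close>. Modulo it \<open>x\<close> is an inverse of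
      \<open>c\<close>, so \<open>e = 1\<close> suffices below.\<close>
    define m where "m = pCons (- 1) p"
    show thesis
    proof (rule that[of m 1])
      show "m \<in> polys_over R"
        using p(1) by (auto simp: m_def polys_over_def coeff_pCons split: nat.splits)
      show "0 < degree m" using \<open>p \<noteq> 0\<close> by (simp add: m_def)
      show "unit_mod (adjoin R x) (adjoin_ideal R I m x) c" if I: "subring_ideal R I" for I
      proof -
        interpret subring_ideal R I by fact
        have "0 \<in> polys_over I" by (simp add: polys_over_def)
        from adjoin_idealI[OF this P.one_mem, of m x]
        have "c * x - 1 \<in> adjoin_ideal R I m x" by (simp add: m_def p mult.commute)
        then show ?thesis using mem_adjoin unfolding unit_mod_def by blast
      qed
      \<comment> \<open>By transcendence only \<open>h = 0\<close> occurs.\<close>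
      show "\<exists>N. \<exists>g\<in>polys_over R. smult (lead_coeff m ^ N) h = m * g"
        if "h \<in> polys_over R" "poly h x = 0" for h
        using that True by (intro exI[of _ 0] bexI[of _ 0]) auto
    qed auto
  next
    case False
    then obtain p where "p \<in> polys_over R" "p \<noteq> 0" "poly p x = 0" by blast
    from exists_kernel_generator[OF R this] obtain m where
      m: "m \<in> polys_over R" "0 < degree m" "poly m x = 0" and
      min: "\<And>h. h \<in> polys_over R \<Longrightarrow> poly h x = 0 \<Longrightarrow> degree h < degree m \<Longrightarrow> h = 0"
      by blast
    from exists_multiple_in_subring[OF R m min c] obtain v where
      v: "v \<in> adjoin R x" "c * v \<in> R" "c * v \<noteq> 0" by blast
    show thesis
    proof (rule that[OF m(1,2) v(2,3)])
      show "\<exists>N. \<exists>g\<in>polys_over R. smult (lead_coeff m ^ N) h = m * g"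
        if "h \<in> polys_over R" "poly h x = 0" for h
        using kernel_multiple[OF R m min that] by simp
      show "unit_mod (adjoin R x) (adjoin_ideal R I m x) c"
        if I: "subring_ideal R I" "unit_mod R I (c * v)" for I
      proof -
        interpret subring_ideal R I by fact
        interpret J: subring_ideal "adjoin R x" "adjoin_ideal R I m x"
          by (rule subring_ideal_adjoin) fact
        show ?thesis
          using J.unit_mod_factor[of c v] unit_mod_mono[OF I(2) subset_adjoin subset_adjoin_ideal]
            c v by blast
      qed
    qed
  qed
qed

text \<open>The hypothesis is applied to the product of \<open>lead_coeff m\<close> and
  \<open>e\<close>, so that both become units modulo the same \<open>I\<close>. The first makes the
  ideal of the extension proper and of finite index, the second makes \<open>c\<close> a
  unit.\<close>

lemma units_survive_adjoin:
  fixes R :: "'a::idom set"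
  assumes "units_survive R"
  shows "units_survive (adjoin R x)"
proof -
  from assms have R: "unital_subring R" by (simp add: units_survive_def)
  interpret unital_subring R by fact
  have "\<exists>J. subring_ideal (adjoin R x) J \<and> 1 \<notin> J \<and> finite_index (adjoin R x) J \<and>
      unit_mod (adjoin R x) J c" if c: "c \<in> adjoin R x" "c \<noteq> 0" for c
  proof -
    from adjoin_presentation[OF R c] obtain m e where
      m: "m \<in> polys_over R" "0 < degree m" and e: "e \<in> R" "e \<noteq> 0" and
      kernel: "\<And>h. h \<in> polys_over R \<Longrightarrow> poly h x = 0 \<Longrightarrow>
        \<exists>N. \<exists>g\<in>polys_over R. smult (lead_coeff m ^ N) h = m * g" and
      unit: "\<And>I. subring_ideal R I \<Longrightarrow> unit_mod R I e \<Longrightarrow>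
        unit_mod (adjoin R x) (adjoin_ideal R I m x) c"
      by blast
    have a: "lead_coeff m \<in> R" "lead_coeff m \<noteq> 0" using polys_overD[OF m(1)] m(2) by auto
    then have "lead_coeff m * e \<in> R" "lead_coeff m * e \<noteq> 0" using e by auto
    with assms obtain I where I: "subring_ideal R I" "1 \<notin> I" "finite_index R I"
      "unit_mod R I (lead_coeff m * e)"
      unfolding units_survive_def by blast
    interpret subring_ideal R I by fact
    have u: "unit_mod R I (lead_coeff m)" "unit_mod R I e"
      using I(4) a(1) e(1) unit_mod_factor mult.commute[of _ e] by metis+
    show ?thesis
      using subring_ideal_adjoin[OF m(1)] one_notin_adjoin_ideal[OF I(2) m u(1) kernel]
        finite_index_adjoin[OF m u(1) I(3)] unit[OF I(1) u(2)] by blast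
  qed
  then show ?thesis using unital_subring_adjoin by (auto simp: units_survive_def)
qed

section \<open>The starting ring: finite domains and the image of the integers\<close>

text \<open>A finite domain is a field: the powers of \<open>c \<noteq> 0\<close> repeat, and
  cancellation leaves a positive power equal to 1. So the zero ideal serves for every
  \<open>c\<close>.\<close>

lemma units_survive_finite:
  fixes R :: "'a::idom set"
  assumes R: "unital_subring R" and fin: "finite R"
  shows "units_survive R"
proof -
  interpret unital_subring R by fact
  interpret subring_ideal R "{0}" by standard auto
  have "unit_mod R {0} c" if c: "c \<in> R" "c \<noteq> 0" for c
  proof -
    have "finite (range (\<lambda>n::nat. c ^ n))"
      using c(1) by (intro finite_subset[OF _ fin]) auto
    then have "\<not> inj (\<lambda>n::nat. c ^ n)" using range_inj_infinite by blast
    then obtain i j :: nat where ij: "i < j" "c ^ i = c ^ j"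
      by (metis injI linorder_neqE_nat)
    then have "c ^ i * c ^ (j - i) = c ^ i"
      by (metis less_imp_le_nat le_add_diff_inverse power_add)
    then have "c ^ i * (c ^ (j - i) - 1) = 0"
      by (simp add: right_diff_distrib)
    then have "c ^ (j - i) = 1" using c by simp
    moreover have "c ^ (j - i) = c * c ^ (j - i - 1)"
      using ij(1) by (simp add: Suc_diff_Suc flip: power_Suc)
    ultimately show ?thesis using c(1) unfolding unit_mod_def by (auto intro!: bexI[of _ "c ^ (j - i - 1)"])
  qed
  moreover have "finite_index R {0}"
    unfolding finite_index_def using fin by (intro exI[of _ R]) auto
  ultimately show ?thesis
    using R subring_ideal_axioms unfolding units_survive_def by fastforce
qed

text \<open>In positive characteristic the image of the integers is finite. In characteristic zero
  it is a copy of the integers, and a modulus coprime to the given \<open>n\<close> is used.\<close>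

lemma units_survive_range_of_int: "units_survive (range (of_int :: int \<Rightarrow> 'a::idom))"
proof -
  let ?Z = "range (of_int :: int \<Rightarrow> 'a)"
  have ring: "unital_subring ?Z"
  proof
    show "1 \<in> ?Z" by (rule range_eqI[of _ _ 1]) simp
  qed (auto simp flip: of_int_diff of_int_mult)
  interpret unital_subring ?Z by (rule ring)
  show ?thesis
  proof (cases "CHAR('a) = 0")
    case False
    have "?Z \<subseteq> of_int ` {0..<int CHAR('a)}"
    proof clarify
      fix z :: int
      have "of_int (z - z mod int CHAR('a)) = (0 :: 'a)"
        by (subst of_int_eq_0_iff_char_dvd) (simp add: minus_mod_eq_mult_div)
      then have "of_int z = (of_int (z mod int CHAR('a)) :: 'a)" by simp
      moreover have "z mod int CHAR('a) \<in> {0..<int CHAR('a)}" using False by simp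
      ultimately show "of_int z \<in> (of_int :: int \<Rightarrow> 'a) ` {0..<int CHAR('a)}" by blast
    qed
    then have "finite ?Z" by (rule finite_subset) simp
    then show ?thesis by (rule units_survive_finite[OF ring])
  next
    case True
    have zero: "of_int z = (0 :: 'a) \<longleftrightarrow> z = 0" for z
      using of_int_eq_0_iff_char_dvd[of z, where 'a = 'a] True by simp
    have "\<exists>I. subring_ideal ?Z I \<and> 1 \<notin> I \<and> finite_index ?Z I \<and> unit_mod ?Z I (of_int n)"
      if n: "of_int n \<noteq> (0 :: 'a)" for n :: int
    proof -
      \<comment> \<open>This modulus makes \<open>n\<close> its own inverse, as
        \<open>n * n - 1 = (\<bar>n\<bar> - 1) * M\<close>. Since \<open>n \<noteq> 0\<close>, it is
        at least 2 and the ideal is proper.\<close>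
      define M where "M = \<bar>n\<bar> + 1"
      have M: "2 \<le> M" using n by (cases "n = 0") (auto simp: M_def)
      define I where "I = range (\<lambda>k::int. of_int (k * M) :: 'a)"
      have I: "of_int z \<in> I" if "M dvd z" for z
        using that by (auto simp: I_def dvd_def mult.commute)
      have "subring_ideal ?Z I"
      proof
        show "I \<subseteq> ?Z" unfolding I_def by blast
        show "0 \<in> I" using I[of 0] by simp
        show "a + b \<in> I" if "a \<in> I" "b \<in> I" for a b
        proof -
          from that obtain k l where "a = of_int (k * M)" "b = of_int (l * M)"
            unfolding I_def by blast
          then show ?thesis using I[of "k * M + l * M"] by simp
        qed
        show "r * a \<in> I" if "r \<in> ?Z" "a \<in> I" for r a
        proof -
          from that obtain k l where "a = of_int (k * M)" "r = of_int l"
            unfolding I_def by blast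
          then show ?thesis using I[of "l * (k * M)"] by simp
        qed
      qed
      moreover have "1 \<notin> I"
      proof
        assume "1 \<in> I"
        then obtain k where "of_int (k * M - 1) = (0 :: 'a)" by (auto simp: I_def)
        then have "k * M = 1" using zero[of "k * M - 1"] by linarith
        then show False using M by (simp add: zmult_eq_1_iff)
      qed
      moreover have "finite_index ?Z I"
        unfolding finite_index_def
      proof (intro exI conjI ballI)
        show "finite ((of_int :: int \<Rightarrow> 'a) ` {0..<M})" by simp
        fix r assume "r \<in> ?Z"
        then obtain z where "r = of_int z" by blast
        moreover have "of_int (z - z mod M) \<in> I" by (rule I) (simp add: minus_mod_eq_mult_div)
        ultimately show "\<exists>t\<in>of_int ` {0..<M}. r - t \<in> I"
          using M by (intro bexI[of _ "of_int (z mod M)"]) auto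
      qed
      moreover have "unit_mod ?Z I (of_int n)"
      proof -
        have "n * n - 1 = (\<bar>n\<bar> - 1) * M" by (simp add: M_def algebra_simps)
        then have "of_int (n * n - 1) \<in> I" by (intro I) simp
        then show ?thesis unfolding unit_mod_def by (intro bexI[of _ "of_int n"]) auto
      qed
      ultimately show ?thesis by blast
    qed
    then show ?thesis using ring by (auto simp: units_survive_def)
  qed
qed

lemma exists_units_survive_superset:
  fixes X :: "'a::idom set"
  assumes "finite X"
  shows "\<exists>R. units_survive R \<and> X \<subseteq> R"
  using assms
proof (induction X)
  case empty
  then show ?case using units_survive_range_of_int by blast
next
  case (insert x X)
  then obtain R where R: "units_survive R" "X \<subseteq> R" by blast
  then interpret unital_subring R by (simp add: units_survive_def)
  show ?case
    using units_survive_adjoin[OF R(1), of x] R(2) subset_adjoin[of x] mem_adjoin[of x] by blast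
qed

section \<open>The group ring acting on configurations\<close>

text \<open>The shift \<open>g + h\<close> is on the right, so that the action commutes with left
  translation of configurations and turns products in the group ring into compositions in the same
  order.\<close>

definition ring_act :: "('g::group_add \<Rightarrow>\<^sub>0 'k::comm_ring_1) \<Rightarrow> ('g \<Rightarrow> 'k) \<Rightarrow> 'g \<Rightarrow> 'k" where
  "ring_act \<alpha> f g = (\<Sum>h\<in>Poly_Mapping.keys \<alpha>. Poly_Mapping.lookup \<alpha> h * f (g + h))"

lemma ring_act_superset:
  assumes "finite S" "Poly_Mapping.keys \<alpha> \<subseteq> S"
  shows "ring_act \<alpha> f g = (\<Sum>h\<in>S. Poly_Mapping.lookup \<alpha> h * f (g + h))"
  unfolding ring_act_def using assms
  by (intro sum.mono_neutral_left) (auto simp: in_keys_iff)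

lemma ring_act_single: "ring_act (Poly_Mapping.single k c) f g = c * f (g + k)"
  by (subst ring_act_superset[of "{k}"]) (auto simp: lookup_single)

lemma ring_act_0 [simp]: "ring_act 0 f g = 0"
  by (simp add: ring_act_def)

lemma ring_act_1 [simp]: "ring_act 1 f g = f g"
  using ring_act_single[of 0 1 f g] by simp

lemma ring_act_add: "ring_act (\<alpha> + \<beta>) f g = ring_act \<alpha> f g + ring_act \<beta> f g"
proof -
  let ?S = "Poly_Mapping.keys \<alpha> \<union> Poly_Mapping.keys \<beta>"
  have "ring_act \<gamma> f g = (\<Sum>h\<in>?S. Poly_Mapping.lookup \<gamma> h * f (g + h))"
    if "\<gamma> \<in> {\<alpha>, \<beta>, \<alpha> + \<beta>}" for \<gamma>
    using that keys_add[of \<alpha> \<beta>] by (intro ring_act_superset) auto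
  then show ?thesis
    by (simp add: lookup_add algebra_simps sum.distrib)
qed

lemma ring_act_sum: "ring_act (\<Sum>i\<in>S. \<alpha> i) f g = (\<Sum>i\<in>S. ring_act (\<alpha> i) f g)"
  by (induction S rule: infinite_finite_induct) (simp_all add: ring_act_add)

lemma ring_act_sum_right: "ring_act \<alpha> (\<lambda>g. \<Sum>i\<in>S. f i g) g = (\<Sum>i\<in>S. ring_act \<alpha> (f i) g)"
  unfolding ring_act_def sum_distrib_left by (rule sum.swap)

lemma ring_act_diff_right:
  "ring_act \<alpha> (\<lambda>g. f g - f' g) g = ring_act \<alpha> f g - ring_act \<alpha> f' g"
  by (simp add: ring_act_def algebra_simps sum_subtractf)

lemma poly_mapping_eq_sum_single:
  "\<alpha> = (\<Sum>k\<in>Poly_Mapping.keys \<alpha>. Poly_Mapping.single k (Poly_Mapping.lookup \<alpha> k))"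
  by (rule poly_mapping_eqI)
    (simp add: lookup_sum lookup_single when_def sum.delta in_keys_iff)

text \<open>Both sides are additive in each factor, so it suffices to treat single group elements,
  where \<open>g + (k + l) = (g + k) + l\<close>.\<close>

lemma ring_act_mult: "ring_act (\<alpha> * \<beta>) f g = ring_act \<alpha> (ring_act \<beta> f) g"
proof -
  have "ring_act (\<alpha> * \<beta>) f g =
    ring_act ((\<Sum>k\<in>Poly_Mapping.keys \<alpha>. Poly_Mapping.single k (Poly_Mapping.lookup \<alpha> k)) *
      (\<Sum>l\<in>Poly_Mapping.keys \<beta>. Poly_Mapping.single l (Poly_Mapping.lookup \<beta> l))) f g"
    by (simp flip: poly_mapping_eq_sum_single)
  also have "\<dots> = ring_act \<alpha> (ring_act \<beta> f) g"
    by (simp add: sum_product mult_single ring_act_sum ring_act_single)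
      (simp add: ring_act_def sum_distrib_left add.assoc mult.assoc)
  finally show ?thesis .
qed

section \<open>Matrices over the group ring acting on vector-valued functions\<close>

text \<open>Matrix times column vector, with the entries acting through \<open>ring_act\<close>. For
  a \<open>d\<close> by \<open>d\<close> matrix only the indices \<open>i < d\<close> carry
  meaning.\<close>

definition mat_act ::
  "nat \<Rightarrow> ('g::group_add \<Rightarrow>\<^sub>0 'k::comm_ring_1) mat \<Rightarrow> ('g \<Rightarrow> nat \<Rightarrow> 'k) \<Rightarrow> 'g \<Rightarrow> nat \<Rightarrow> 'k" where
  "mat_act d M x g i = (\<Sum>j<d. ring_act (M $$ (i, j)) (\<lambda>h. x h j) g)"

lemma mat_act_mult:
  assumes M: "M \<in> carrier_mat d d" and N: "N \<in> carrier_mat d d" and i: "i < d"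
  shows "mat_act d (M * N) x g i = mat_act d M (mat_act d N x) g i"
proof -
  have "mat_act d (M * N) x g i =
    (\<Sum>l<d. ring_act (\<Sum>j<d. M $$ (i, j) * N $$ (j, l)) (\<lambda>h. x h l) g)"
    unfolding mat_act_def using M N i
    by (intro sum.cong refl arg_cong[where f = "\<lambda>\<alpha>. ring_act \<alpha> _ _"])
      (auto simp: scalar_prod_def atLeast0LessThan)
  also have "\<dots> = (\<Sum>l<d. \<Sum>j<d. ring_act (M $$ (i, j)) (ring_act (N $$ (j, l)) (\<lambda>h. x h l)) g)"
    by (simp add: ring_act_sum ring_act_mult)
  also have "\<dots> = (\<Sum>j<d. \<Sum>l<d. ring_act (M $$ (i, j)) (ring_act (N $$ (j, l)) (\<lambda>h. x h l)) g)"
    by (rule sum.swap)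
  also have "\<dots> = mat_act d M (mat_act d N x) g i"
    unfolding mat_act_def by (simp add: ring_act_sum_right)
  finally show ?thesis .
qed

lemma mat_act_one:
  assumes "i < d"
  shows "mat_act d (1\<^sub>m d) x g i = x g i"
proof -
  have "mat_act d (1\<^sub>m d) x g i = (\<Sum>j<d. if i = j then x g j else 0)"
    unfolding mat_act_def using assms by (intro sum.cong) auto
  then show ?thesis using assms by (simp add: sum.delta')
qed

lemma mat_act_translate: "mat_act d M (x \<circ> (+) k) g = mat_act d M x (k + g)"
  by (simp add: fun_eq_iff mat_act_def ring_act_def add.assoc)

lemma mat_act_cong:
  assumes "\<And>i j h. i < d \<Longrightarrow> j < d \<Longrightarrow> h \<in> Poly_Mapping.keys (M $$ (i, j)) \<Longrightarrow> x (g + h) j = y (g + h) j"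
    and "i < d"
  shows "mat_act d M x g i = mat_act d M y g i"
  unfolding mat_act_def ring_act_def using assms by (auto intro!: sum.cong)

lemma mat_act_diff:
  "mat_act d M (\<lambda>g i. x g i - y g i) g i = mat_act d M x g i - mat_act d M y g i"
  by (simp add: mat_act_def ring_act_diff_right sum_subtractf)

text \<open>Acting on the \<open>j\<close>-th unit vector placed at \<open>k\<close> and evaluating
  at the neutral element reads off a single coefficient of a matrix entry.\<close>

lemma mat_act_delta:
  assumes "j < d"
  shows "mat_act d M (\<lambda>g i. if g = k \<and> i = j then 1 else 0) 0 i = Poly_Mapping.lookup (M $$ (i, j)) k"
proof -
  have "mat_act d M (\<lambda>g i. if g = k \<and> i = j then 1 else 0) 0 i =
    (\<Sum>l<d. if l = j then Poly_Mapping.lookup (M $$ (i, j)) k else 0)"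
    unfolding mat_act_def
  proof (rule sum.cong)
    fix l
    let ?K = "Poly_Mapping.keys (M $$ (i, l))"
    have "(\<Sum>h\<in>?K. Poly_Mapping.lookup (M $$ (i, l)) h * (if h = k \<and> l = j then 1 else 0)) =
      (\<Sum>h\<in>?K. if h = k then (if l = j then Poly_Mapping.lookup (M $$ (i, l)) k else 0) else 0)"
      by (rule sum.cong) auto
    then show "ring_act (M $$ (i, l)) (\<lambda>h. if h = k \<and> l = j then 1 else 0) 0 =
      (if l = j then Poly_Mapping.lookup (M $$ (i, j)) k else 0)"
      by (auto simp: ring_act_def sum.delta in_keys_iff)
  qed simp
  then show ?thesis using assms by (simp add: sum.delta)
qed

definition coeffs_in :: "'k set \<Rightarrow> nat \<Rightarrow> ('g \<Rightarrow>\<^sub>0 'k::zero) mat \<Rightarrow> bool" where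
  "coeffs_in R d M \<longleftrightarrow> (\<forall>i<d. \<forall>j<d. \<forall>h. Poly_Mapping.lookup (M $$ (i, j)) h \<in> R)"

lemma (in unital_subring) mat_act_mem:
  assumes "coeffs_in R d M" "\<And>g j. j < d \<Longrightarrow> x g j \<in> R" "i < d"
  shows "mat_act d M x g i \<in> R"
  using assms unfolding mat_act_def ring_act_def coeffs_in_def
  by (auto intro!: sum_mem mult_mem)

lemma (in subring_ideal) mat_act_ideal:
  assumes "coeffs_in R d M" "\<And>g j. j < d \<Longrightarrow> x g j \<in> I" "i < d"
  shows "mat_act d M x g i \<in> I"
  using assms unfolding mat_act_def ring_act_def coeffs_in_def
  by (auto intro!: ideal_sum ideal_mult)

text \<open>The coefficients of the product are read off from its action on delta functions, whose
  values 0 and 1 lie in \<open>R\<close>; each factor preserves \<open>R\<close>-valued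
  functions.\<close>

lemma (in unital_subring) coeffs_in_mult:
  fixes M N :: "('g::group_add \<Rightarrow>\<^sub>0 'a) mat"
  assumes M: "M \<in> carrier_mat d d" "coeffs_in R d M" and N: "N \<in> carrier_mat d d" "coeffs_in R d N"
  shows "coeffs_in R d (M * N)"
  unfolding coeffs_in_def
proof (intro allI impI)
  fix i j h assume ij: "i < d" "j < d"
  have "mat_act d (M * N) (\<lambda>g l. if g = h \<and> l = j then 1 else 0) 0 i \<in> R"
    unfolding mat_act_mult[OF M(1) N(1) ij(1)]
    using ij by (intro mat_act_mem M N) auto
  then show "Poly_Mapping.lookup ((M * N) $$ (i, j)) h \<in> R"
    using ij by (simp add: mat_act_delta)
qed

section \<open>Cellular automata over a finite quotient\<close>

text \<open>A map depending on finitely many coordinates is locally constant: it is constant on the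
  cylinder \<open>V\<close> of configurations that agree with \<open>x\<close> on
  \<open>S\<close>.\<close>

lemma continuous_map_prodiscrete_discrete:
  fixes f :: "('g \<Rightarrow> 'a) \<Rightarrow> 'b"
  assumes f: "f \<in> configs G A \<rightarrow> B" and S: "finite S"
    and local: "\<And>x y. x \<in> configs G A \<Longrightarrow> y \<in> configs G A \<Longrightarrow> (\<And>s. s \<in> S \<Longrightarrow> x s = y s) \<Longrightarrow> f x = f y"
  shows "continuous_map (prodiscrete G A) (discrete_topology B) f"
proof -
  have "openin (prodiscrete G A) {x \<in> configs G A. f x \<in> U}" for U
  proof (subst openin_subopen, intro ballI)
    fix x assume x: "x \<in> {x \<in> configs G A. f x \<in> U}"
    define V where "V = (\<Pi>\<^sub>E g\<in>UNIV. if g \<in> S then {x g} else A)"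
    have "openin (prodiscrete G A) V"
      unfolding prodiscrete_def V_def
    proof (rule product_topology_basis)
      show "openin (discrete_topology A) (if g \<in> S then {x g} else A)" for g
        using x by (auto simp: configs_def)
      show "finite {g. (if g \<in> S then {x g} else A) \<noteq> topspace (discrete_topology A)}"
        by (rule finite_subset[OF _ S]) auto
    qed
    moreover have "x \<in> V" using x by (auto simp: V_def configs_def)
    moreover have "V \<subseteq> {x \<in> configs G A. f x \<in> U}"
    proof
      fix y assume y: "y \<in> V"
      have ys: "y g \<in> (if g \<in> S then {x g} else A)" for g
        using y unfolding V_def by (rule PiE_mem) simp
      have yA: "y g \<in> A" for g
        using ys[of g] x by (auto simp: configs_def split: if_splits)
      then have "y \<in> configs G A" by (auto simp: configs_def)
      moreover have "f x = f y"
      proof (rule local)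
        show "x s = y s" if "s \<in> S" for s using ys[of s] that by simp
      qed (use x \<open>y \<in> configs G A\<close> in auto)
      ultimately show "y \<in> {x \<in> configs G A. f x \<in> U}" using x by auto
    qed
    ultimately show "\<exists>T. openin (prodiscrete G A) T \<and> x \<in> T \<and> T \<subseteq> {x \<in> configs G A. f x \<in> U}"
      by blast
  qed
  then show ?thesis using f by (auto simp: continuous_map_def Pi_def)
qed

locale finite_index_ideal = subring_ideal R I for R I :: "'k::comm_ring_1 set" +
  assumes fin_index: "finite_index R I"
begin

text \<open>
  The elements of \<open>R/I\<close> are encoded by representatives in \<open>R\<close>, so that the alphabet is again a set
  of functions with values in the field.
\<close>
definition reps :: "'k set" where
  "reps = (SOME T. finite T \<and> (\<forall>r\<in>R. \<exists>t\<in>T. r - t \<in> I))"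

definition rep :: "'k \<Rightarrow> 'k" where
  "rep r = (SOME t. t \<in> reps \<and> r - t \<in> I)"

lemma reps: "finite reps" "r \<in> R \<Longrightarrow> \<exists>t\<in>reps. r - t \<in> I"
proof -
  have "finite reps \<and> (\<forall>r\<in>R. \<exists>t\<in>reps. r - t \<in> I)"
    unfolding reps_def using fin_index unfolding finite_index_def by (rule someI_ex)
  then show "finite reps" "r \<in> R \<Longrightarrow> \<exists>t\<in>reps. r - t \<in> I" by auto
qed

lemma rep: assumes "r \<in> R" shows "rep r \<in> reps" "r - rep r \<in> I"
  using someI_ex[of "\<lambda>t. t \<in> reps \<and> r - t \<in> I"] reps(2)[OF assms] unfolding rep_def by blast+

lemma rep_mem: assumes "r \<in> R" shows "rep r \<in> R"
  using diff_mem[OF assms ideal_mem[OF rep(2)[OF assms]]] by simp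

text \<open>Congruent elements satisfy the same predicate under \<open>SOME\<close>, so the chosen
  representatives are equal and not only congruent.\<close>

lemma rep_cong: assumes "r - s \<in> I" shows "rep r = rep s"
proof -
  have "r - t \<in> I \<longleftrightarrow> s - t \<in> I" for t
    using assms ideal_diff_trans ideal_diff_commute by blast
  then show ?thesis by (simp add: rep_def)
qed

lemma rep_eqD: assumes "r \<in> R" "s \<in> R" "rep r = rep s" shows "r - s \<in> I"
  using rep(2)[OF assms(1)] rep(2)[OF assms(2)] assms(3) ideal_diff_trans ideal_diff_commute
  by metis

lemma rep_rep: "r \<in> R \<Longrightarrow> rep (rep r) = rep r"
  using rep_cong rep(2) by metis

text \<open>The letters encode \<open>(R/I)^d\<close>. The image of \<open>rep\<close> is taken
  rather than \<open>reps\<close>, which may contain several elements of one class.\<close>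

definition alphabet :: "nat \<Rightarrow> (nat \<Rightarrow> 'k) set" where
  "alphabet d = {..<d} \<rightarrow>\<^sub>E rep ` R"

text \<open>Reduction modulo \<open>I\<close> is applied only to the output, so the automaton can
  also be fed \<open>R\<close>-valued functions that are not configurations over the
  alphabet.\<close>

definition automaton ::
  "nat \<Rightarrow> ('g::group_add \<Rightarrow>\<^sub>0 'k) mat \<Rightarrow> ('g \<Rightarrow> nat \<Rightarrow> 'k) \<Rightarrow> 'g \<Rightarrow> nat \<Rightarrow> 'k" where
  "automaton d M x g = (\<lambda>i\<in>{..<d}. rep (mat_act d M x g i))"

lemma finite_alphabet: "finite (alphabet d)"
  unfolding alphabet_def using reps(1) rep(1)
  by (intro finite_PiE) (auto intro: finite_subset[of _ reps])

lemma configs_alphabetI: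
  "(\<And>g. x g \<in> extensional {..<d}) \<Longrightarrow> (\<And>g i. i < d \<Longrightarrow> x g i \<in> rep ` R) \<Longrightarrow> x \<in> configs G (alphabet d)"
  unfolding configs_def alphabet_def PiE_def by auto

lemma configs_alphabetD:
  assumes "x \<in> configs G (alphabet d)"
  shows "x g \<in> extensional {..<d}" "i < d \<Longrightarrow> x g i \<in> rep ` R" "i < d \<Longrightarrow> x g i \<in> R"
proof -
  have "x g \<in> {..<d} \<rightarrow>\<^sub>E rep ` R" using assms by (auto simp: configs_def alphabet_def)
  then show "x g \<in> extensional {..<d}" "i < d \<Longrightarrow> x g i \<in> rep ` R" "i < d \<Longrightarrow> x g i \<in> R"
    using rep_mem by (auto simp: PiE_def Pi_def)
qed

lemma automaton_configs:
  assumes "coeffs_in R d M" "\<And>g i. i < d \<Longrightarrow> x g i \<in> R"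
  shows "automaton d M x \<in> configs G (alphabet d)"
  using mat_act_mem[OF assms] by (intro configs_alphabetI) (auto simp: automaton_def)

text \<open>By linearity: a matrix over \<open>R\<close> maps the \<open>I\<close>-valued difference
  of \<open>x\<close> and \<open>y\<close> to an \<open>I\<close>-valued function.\<close>

lemma automaton_cong:
  assumes M: "coeffs_in R d M" and xy: "\<And>g i. i < d \<Longrightarrow> x g i - y g i \<in> I"
  shows "automaton d M x = automaton d M y"
proof -
  have "mat_act d M x g i - mat_act d M y g i \<in> I" if "i < d" for g i
    using mat_act_ideal[OF M, of "\<lambda>g i. x g i - y g i" i g] xy that by (simp add: mat_act_diff)
  then show ?thesis
    unfolding automaton_def by (auto intro!: ext rep_cong simp: restrict_def)
qed

text \<open>The inner reduction changes values only by elements of \<open>I\<close>, which the outer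
  automaton does not see.\<close>

lemma automaton_mult:
  assumes M: "M \<in> carrier_mat d d" "coeffs_in R d M" and N: "N \<in> carrier_mat d d" "coeffs_in R d N"
    and x: "\<And>g i. i < d \<Longrightarrow> x g i \<in> R"
  shows "automaton d M (automaton d N x) = automaton d (M * N) x"
proof -
  have "automaton d M (automaton d N x) = automaton d M (mat_act d N x)"
  proof (rule automaton_cong[OF M(2)])
    fix g i assume "i < d"
    then show "automaton d N x g i - mat_act d N x g i \<in> I"
      using rep(2)[OF mat_act_mem[OF N(2) x]] by (simp add: automaton_def ideal_diff_commute)
  qed
  also have "\<dots> = automaton d (M * N) x"
    unfolding automaton_def by (auto intro!: ext simp: restrict_def mat_act_mult[OF M(1) N(1)])
  finally show ?thesis .
qed

lemma automaton_one:
  assumes "x \<in> configs G (alphabet d)"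
  shows "automaton d (1\<^sub>m d) x = x"
proof (intro ext)
  fix g i
  show "automaton d (1\<^sub>m d) x g i = x g i"
  proof (cases "i < d")
    case True
    then show ?thesis
      using configs_alphabetD(2)[OF assms, of i g] by (auto simp: automaton_def mat_act_one rep_rep)
  next
    case False
    then show ?thesis
      using configs_alphabetD(1)[OF assms, of g] by (simp add: automaton_def extensional_def)
  qed
qed

lemma equivariant_automaton: "equivariant G (alphabet d) (automaton d M)"
  unfolding equivariant_def by (auto simp: automaton_def mat_act_translate fun_eq_iff)

text \<open>The output at \<open>g\<close> depends only on the input at the translates by
  \<open>g\<close> of the finite supports of the entries.\<close>

lemma continuous_map_automaton:
  fixes M :: "('g::group_add \<Rightarrow>\<^sub>0 'k) mat" and G :: "'g itself"
  assumes M: "coeffs_in R d M"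
  shows "continuous_map (prodiscrete G (alphabet d)) (prodiscrete G (alphabet d)) (automaton d M)"
proof -
  have "continuous_map (prodiscrete G (alphabet d)) (discrete_topology (alphabet d))
      (\<lambda>x. automaton d M x g)" for g
  proof (rule continuous_map_prodiscrete_discrete)
    show "(\<lambda>x. automaton d M x g) \<in> configs G (alphabet d) \<rightarrow> alphabet d"
    proof
      fix x :: "'g \<Rightarrow> nat \<Rightarrow> 'k" assume "x \<in> configs G (alphabet d)"
      then have "automaton d M x \<in> configs G (alphabet d)"
        by (intro automaton_configs M configs_alphabetD)
      then show "automaton d M x g \<in> alphabet d" by (auto simp: configs_def)
    qed
    let ?S = "\<Union>i<d. \<Union>j<d. (+) g ` Poly_Mapping.keys (M $$ (i, j))"
    show "finite ?S" by auto
    fix x y :: "'g \<Rightarrow> nat \<Rightarrow> 'k" assume xy: "\<And>s. s \<in> ?S \<Longrightarrow> x s = y s"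
    have "mat_act d M x g i = mat_act d M y g i" if "i < d" for i
    proof (rule mat_act_cong[OF _ that])
      fix i j h assume "i < d" "j < d" "h \<in> Poly_Mapping.keys (M $$ (i, j))"
      then have "g + h \<in> ?S" by blast
      then show "x (g + h) j = y (g + h) j" using xy by simp
    qed
    then show "automaton d M x g = automaton d M y g"
      by (auto simp: automaton_def restrict_def)
  qed
  then show ?thesis
    unfolding prodiscrete_def[of G "alphabet d"] continuous_map_componentwise_UNIV by blast
qed

text \<open>The automaton of \<open>A\<close> is a left inverse of that of \<open>B\<close>, which
  is therefore injective and, by surjunctivity, bijective. So \<open>B * A\<close> acts as the
  identity modulo \<open>I\<close>, and a delta function reveals its coefficients.\<close>

lemma right_inverse_left_inverse_mod:
  fixes A B :: "('g::group_add \<Rightarrow>\<^sub>0 'k) mat"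
  assumes G: "surjunctive TYPE('g)"
    and A: "A \<in> carrier_mat d d" "coeffs_in R d A" and B: "B \<in> carrier_mat d d" "coeffs_in R d B"
    and AB: "A * B = 1\<^sub>m d" and ij: "i < d" "j < d"
  shows "Poly_Mapping.lookup ((B * A) $$ (i, j)) k - Poly_Mapping.lookup (1\<^sub>m d $$ (i, j)) k \<in> I"
proof -
  let ?C = "configs TYPE('g) (alphabet d)"
  have left_inverse: "automaton d A (automaton d B x) = x" if "x \<in> ?C" for x
    using automaton_mult[OF A B configs_alphabetD(3)[OF that]] automaton_one[OF that] AB by simp
  have surj: "automaton d B ` ?C = ?C"
  proof (rule surjunctive_alphabetI[OF G finite_alphabet, unfolded surjunctive_alphabet_def, rule_format],
      intro conjI)
    show "automaton d B \<in> ?C \<rightarrow> ?C" by (intro Pi_I automaton_configs B configs_alphabetD)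
    show "inj_on (automaton d B) ?C" by (rule inj_on_inverseI) (rule left_inverse)
  qed (intro equivariant_automaton continuous_map_automaton B)+
  have right_inverse: "automaton d B (automaton d A y) = y" if "y \<in> ?C" for y
  proof -
    from that have "y \<in> automaton d B ` ?C" by (simp only: surj)
    then obtain x where "y = automaton d B x" "x \<in> ?C" by (rule imageE)
    then show ?thesis by (simp only: left_inverse)
  qed
  have I1: "coeffs_in R d (1\<^sub>m d :: ('g \<Rightarrow>\<^sub>0 'k) mat)"
    by (auto simp: coeffs_in_def lookup_one when_def)
  define \<delta> :: "'g \<Rightarrow> nat \<Rightarrow> 'k" where "\<delta> = (\<lambda>g i. if g = k \<and> i = j then 1 else 0)"
  have \<delta>: "\<delta> g i \<in> R" for g i by (simp add: \<delta>_def)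
  \<comment> \<open>\<open>\<delta>\<close> reduced to the alphabet: 0 and 1 need not be their own
    representatives.\<close>
  define y where "y = automaton d (1\<^sub>m d) \<delta>"
  have y: "y \<in> ?C" unfolding y_def by (intro automaton_configs I1 \<delta>)
  have "automaton d (B * A) \<delta> = automaton d (B * A) y"
    using rep(2)[OF \<delta>] by (intro automaton_cong coeffs_in_mult A B)
      (simp add: y_def automaton_def mat_act_one)
  also have "\<dots> = y"
    using automaton_mult[OF B A configs_alphabetD(3)[OF y]] right_inverse[OF y] by simp
  finally have "automaton d (B * A) \<delta> 0 i = automaton d (1\<^sub>m d) \<delta> 0 i" by (simp add: y_def)
  then have "rep (mat_act d (B * A) \<delta> 0 i) = rep (mat_act d (1\<^sub>m d) \<delta> 0 i)"
    using ij by (simp add: automaton_def)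
  then have "mat_act d (B * A) \<delta> 0 i - mat_act d (1\<^sub>m d) \<delta> 0 i \<in> I"
    using ij \<delta> by (intro rep_eqD mat_act_mem coeffs_in_mult A B I1)
  then show ?thesis using ij by (simp add: \<delta>_def mat_act_delta)
qed

end

section \<open>Stable finiteness of the group ring\<close>

theorem theorem1p1:
  assumes "surjunctive TYPE('g::group_add)"
  shows "stably_finite TYPE('g \<Rightarrow>\<^sub>0 'k::field)"
  unfolding stably_finite_iff
proof (intro allI impI ballI)
  fix d :: nat and A B :: "('g \<Rightarrow>\<^sub>0 'k) mat"
  assume A: "A \<in> carrier_mat d d" and B: "B \<in> carrier_mat d d" and AB: "A * B = 1\<^sub>m d"
  define X where "X = (\<Union>M\<in>{A, B}. \<Union>i<d. \<Union>j<d. range (Poly_Mapping.lookup (M $$ (i, j))))"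
  \<comment> \<open>The values are those on the finite support, together with 0.\<close>
  have "finite (range (Poly_Mapping.lookup \<alpha>))" for \<alpha> :: "'g \<Rightarrow>\<^sub>0 'k"
    by (rule finite_subset[of _ "insert 0 (Poly_Mapping.lookup \<alpha> ` Poly_Mapping.keys \<alpha>)"])
      (auto simp: in_keys_iff)
  then have "finite X" by (auto simp: X_def)
  then obtain R where R: "units_survive R" "X \<subseteq> R"
    using exists_units_survive_superset by blast
  interpret unital_subring R using R(1) by (simp add: units_survive_def)
  have "Poly_Mapping.lookup (M $$ (i, j)) h \<in> R" if "M \<in> {A, B}" "i < d" "j < d" for M i j h
  proof -
    have "Poly_Mapping.lookup (M $$ (i, j)) h \<in> X"
      unfolding X_def using that by blast
    then show ?thesis using R(2) by (rule subsetD[rotated])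
  qed
  then have cA: "coeffs_in R d A" and cB: "coeffs_in R d B"
    unfolding coeffs_in_def by simp_all
  show "B * A = 1\<^sub>m d"
  proof (rule eq_matI)
    fix i j assume "i < dim_row (1\<^sub>m d :: ('g \<Rightarrow>\<^sub>0 'k) mat)" "j < dim_col (1\<^sub>m d :: ('g \<Rightarrow>\<^sub>0 'k) mat)"
    then have ij: "i < d" "j < d" by auto
    show "(B * A) $$ (i, j) = 1\<^sub>m d $$ (i, j)"
    proof (rule poly_mapping_eqI, rule ccontr)
      fix k
      define c where
        "c = Poly_Mapping.lookup ((B * A) $$ (i, j)) k - Poly_Mapping.lookup (1\<^sub>m d $$ (i, j)) k"
      assume "Poly_Mapping.lookup ((B * A) $$ (i, j)) k \<noteq> Poly_Mapping.lookup (1\<^sub>m d $$ (i, j)) k"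
      then have "c \<noteq> 0" by (simp add: c_def)
      moreover have "c \<in> R"
      proof -
        have "Poly_Mapping.lookup ((B * A) $$ (i, j)) k \<in> R"
          using coeffs_in_mult[OF B cB A cA] ij by (simp add: coeffs_in_def)
        moreover have "Poly_Mapping.lookup (1\<^sub>m d $$ (i, j)) k \<in> R"
          using ij by (simp add: lookup_one when_def)
        ultimately show ?thesis unfolding c_def by (rule diff_mem)
      qed
      ultimately obtain I where I: "subring_ideal R I" "1 \<notin> I" "finite_index R I" "unit_mod R I c"
        using R(1) unfolding units_survive_def by blast
      interpret finite_index_ideal R I
        using I by (simp add: finite_index_ideal_def finite_index_ideal_axioms_def)
      have c: "c \<in> I"
        unfolding c_def by (rule right_inverse_left_inverse_mod[OF assms A cA B cB AB ij])
      obtain b where b: "b \<in> R" "c * b - 1 \<in> I" using I(4) by (auto simp: unit_mod_def)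
      \<comment> \<open>A unit modulo \<open>I\<close> that lies in \<open>I\<close> puts 1 into
        \<open>I\<close>.\<close>
      have "c * b - (c * b - 1) \<in> I" by (rule ideal_diff[OF ideal_mult_right[OF b(1) c] b(2)])
      then show False using I(2) by (simp add: algebra_simps)
    qed
  qed (use A B in auto)
qed

end
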